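(* For any $3$-dimensional 0-1 matrix $P$ in $$ \left\{ \left( \begin{pmatrix} 0 & 1 \\ 0 & 0 \end{pmatrix}; \begin{pmatrix} 1 & 0 \\ 1 & 0 \end{pmatrix}; \begin{pmatrix} 0 & 0 \\ 0 & 1 \end{pmatrix} \right), \left( \begin{pmatrix} 0 & 0 \\ 0 & 1 \end{pmatrix}; \begin{pmatrix} 0 & 1 \\ 1 & 0 \end{pmatrix}; \begin{pmatrix} 1 & 0 \\ 0 & 0 \end{pmatrix} \right) \right\}, $$ we have $\operatorname{ex}(n,P,3)=\Theta(n^{2.5})$ and $P$ is minimally non-$O(n^2)$.
   Context: A $3$-dimensional matrix $A$ of dimensions $a\times b\times c$ is written as the list of its layers with first coordinate $1,2,\dots,a$ (separated by semicolons), each being a $b\times c$ matrix whose entry in row $y$, column $z$ of the $x$-th layer is $A(x,y,z)$. Thus both matrices are $3\times2\times2$; the first has $1$-entries exactly at $(1,1,2),(2,1,1),(2,2,1),(3,2,2)$, and the second exactly at $(1,2,2),(2,1,2),(2,2,1),(3,1,1)$. A $d$-dimensional 0-1 matrix $A$ contains a $d$-dimensional 0-1 matrix $P$ if $A$ has a submatrix (obtained by restricting each of the $d$ coordinates to a subset of its range) of the same dimensions as $P$ that can be turned into $P$ by changing any number of $1$-entries to $0$-entries; otherwise $A$ is $P$-free. $P'$ is properly contained in $P$ if $P$ contains $P'$ and $P'\neq P$. $\operatorname{ex}(n,P,d)$ is the maximum possible number of $1$-entries in a $P$-free $d$-dimensional $n\times\dots\times n$ 0-1 matrix (taken to be $0$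 if no such matrix exists). A $3$-dimensional 0-1 matrix $P$ is minimally non-$O(n^2)$ if $\operatorname{ex}(n,P,3)=\omega(n^2)$ but $\operatorname{ex}(n,P',3)=O(n^2)$ for every $3$-dimensional 0-1 matrix $P'$ properly contained in $P$. Asymptotics are for $n\to\infty$. *)

theory Defs
  imports Complex_Main "HOL-Library.Landau_Symbols"
begin

text \<open>
  A 3-dimensional 0-1 matrix is given by its dimensions and the set of positions of its
  1-entries; positions are counted from 1. With the side condition \<open>is_mat3\<close> this
  representation is unique, so equality of values of the type is equality of matrices.
\<close>

datatype mat3 =
  Mat3 (dim1: nat) (dim2: nat) (dim3: nat) (ones: "(nat \<times> nat \<times> nat) set")

definition is_mat3 :: "mat3 \<Rightarrow> bool" where
  "is_mat3 A \<longleftrightarrow>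
     dim1 A \<ge> 1 \<and> dim2 A \<ge> 1 \<and> dim3 A \<ge> 1 \<and>
     ones A \<subseteq> {1..dim1 A} \<times> {1..dim2 A} \<times> {1..dim3 A}"

text \<open>
  The entry in row \<open>y\<close>, column \<open>z\<close> of the \<open>x\<close>-th layer is the one at position \<open>(x, y, z)\<close>.
  All layers are supposed to be of the same size.
\<close>

definition mat3_of_layers :: "nat list list list \<Rightarrow> mat3" where
  "mat3_of_layers L =
     (let a = length L; b = length (hd L); c = length (hd (hd L)) in
      Mat3 a b c {(x, y, z). x \<in> {1..a} \<and> y \<in> {1..b} \<and> z \<in> {1..c} \<and>
                             L ! (x - 1) ! (y - 1) ! (z - 1) = 1})"

text \<open>The \<open>i\<close>-th smallest element (counted from 1) of a finite set.\<close>

definition nth_elem :: "nat set \<Rightarrow> nat \<Rightarrow> nat" where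
  "nth_elem X i = sorted_list_of_set X ! (i - 1)"

text \<open>The restriction of the three coordinates to \<open>X\<close>, \<open>Y\<close>, \<open>Z\<close>, with coordinates renumbered.\<close>

definition submat3 :: "mat3 \<Rightarrow> nat set \<Rightarrow> nat set \<Rightarrow> nat set \<Rightarrow> mat3" where
  "submat3 A X Y Z =
     Mat3 (card X) (card Y) (card Z)
       {(i, j, k). i \<in> {1..card X} \<and> j \<in> {1..card Y} \<and> k \<in> {1..card Z} \<and>
                   (nth_elem X i, nth_elem Y j, nth_elem Z k) \<in> ones A}"

definition contains :: "mat3 \<Rightarrow> mat3 \<Rightarrow> bool" where
  "contains A P \<longleftrightarrow>
     (\<exists>X Y Z. X \<subseteq> {1..dim1 A} \<and> Y \<subseteq> {1..dim2 A} \<and> Z \<subseteq> {1..dim3 A} \<and>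
        (let B = submat3 A X Y Z in
           dim1 B = dim1 P \<and> dim2 B = dim2 P \<and> dim3 B = dim3 P \<and> ones P \<subseteq> ones B))"

definition properly_contained :: "mat3 \<Rightarrow> mat3 \<Rightarrow> bool" where
  "properly_contained P' P \<longleftrightarrow> contains P P' \<and> P' \<noteq> P"

definition free_mats :: "nat \<Rightarrow> mat3 \<Rightarrow> mat3 set" where
  "free_mats n P =
     {A. is_mat3 A \<and> dim1 A = n \<and> dim2 A = n \<and> dim3 A = n \<and> \<not> contains A P}"

definition ex3 :: "nat \<Rightarrow> mat3 \<Rightarrow> nat" where
  "ex3 n P =
     (if free_mats n P = {} then 0 else Max ((\<lambda>A. card (ones A)) ` free_mats n P))"

definition minimally_non_O_n2 :: "mat3 \<Rightarrow> bool" where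
  "minimally_non_O_n2 P \<longleftrightarrow>
     (\<lambda>n. real (ex3 n P)) \<in> \<omega>(\<lambda>n. real n ^ 2) \<and>
     (\<forall>P'. is_mat3 P' \<and> properly_contained P' P \<longrightarrow>
        (\<lambda>n. real (ex3 n P')) \<in> O(\<lambda>n. real n ^ 2))"

text \<open>The maximum in the definition of \<open>ex3\<close> is over a finite set.\<close>

lemma finite_free_mats: "finite (free_mats n P)"
proof (rule finite_subset)
  show "free_mats n P \<subseteq> Mat3 n n n ` Pow ({1..n} \<times> {1..n} \<times> {1..n})"
  proof
    fix A assume "A \<in> free_mats n P"
    then have "A = Mat3 n n n (ones A)" "ones A \<in> Pow ({1..n} \<times> {1..n} \<times> {1..n})"
      by (cases A; simp add: free_mats_def is_mat3_def)+
    then show "A \<in> Mat3 n n n ` Pow ({1..n} \<times> {1..n} \<times> {1..n})"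
      by (rule image_eqI)
  qed
qed simp

text \<open>The positions of the 1-entries of the two matrices considered.\<close>

lemma matrix1_ones:
  "mat3_of_layers [[[0, 1], [0, 0]], [[1, 0], [1, 0]], [[0, 0], [0, 1]]] =
     Mat3 3 2 2 {(1,1,2), (2,1,1), (2,2,1), (3,2,2)}" (is "?P = _")
proof -
  have dims: "dim1 ?P = 3" "dim2 ?P = 2" "dim3 ?P = 2"
    by (simp_all add: mat3_of_layers_def Let_def)
  have "ones ?P = {(1,1,2), (2,1,1), (2,2,1), (3,2,2)}" (is "_ = ?S")
  proof (intro set_eqI)
    fix p :: "nat \<times> nat \<times> nat"
    obtain x y z where p: "p = (x, y, z)" by (cases p)
    show "p \<in> ones ?P \<longleftrightarrow> p \<in> ?S"
    proof (cases "x \<in> {1..3} \<and> y \<in> {1..2} \<and> z \<in> {1..2}")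
      case True
      then have "x = 1 \<or> x = 2 \<or> x = 3" "y = 1 \<or> y = 2" "z = 1 \<or> z = 2" by auto
      then show ?thesis
        unfolding p by (elim disjE; hypsubst) (simp_all add: mat3_of_layers_def Let_def)
    next
      case False
      have "p \<notin> ones ?P"
      proof
        assume "p \<in> ones ?P"
        then have "x \<in> {1..dim1 ?P} \<and> y \<in> {1..dim2 ?P} \<and> z \<in> {1..dim3 ?P}"
          unfolding p by (simp add: mat3_of_layers_def Let_def)
        with False show False unfolding dims by blast
      qed
      moreover have "p \<notin> ?S"
        using False unfolding p by auto
      ultimately show ?thesis by blast
    qed
  qed
  with dims show ?thesis by (metis mat3.collapse)
qed

lemma matrix2_ones:
  "mat3_of_layers [[[0, 0], [0, 1]], [[0, 1], [1, 0]], [[1, 0], [0, 0]]] =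
     Mat3 3 2 2 {(1,2,2), (2,1,2), (2,2,1), (3,1,1)}" (is "?P = _")
proof -
  have dims: "dim1 ?P = 3" "dim2 ?P = 2" "dim3 ?P = 2"
    by (simp_all add: mat3_of_layers_def Let_def)
  have "ones ?P = {(1,2,2), (2,1,2), (2,2,1), (3,1,1)}" (is "_ = ?S")
  proof (intro set_eqI)
    fix p :: "nat \<times> nat \<times> nat"
    obtain x y z where p: "p = (x, y, z)" by (cases p)
    show "p \<in> ones ?P \<longleftrightarrow> p \<in> ?S"
    proof (cases "x \<in> {1..3} \<and> y \<in> {1..2} \<and> z \<in> {1..2}")
      case True
      then have "x = 1 \<or> x = 2 \<or> x = 3" "y = 1 \<or> y = 2" "z = 1 \<or> z = 2" by auto
      then show ?thesis
        unfolding p by (elim disjE; hypsubst) (simp_all add: mat3_of_layers_def Let_def)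
    next
      case False
      have "p \<notin> ones ?P"
      proof
        assume "p \<in> ones ?P"
        then have "x \<in> {1..dim1 ?P} \<and> y \<in> {1..dim2 ?P} \<and> z \<in> {1..dim3 ?P}"
          unfolding p by (simp add: mat3_of_layers_def Let_def)
        with False show False unfolding dims by blast
      qed
      moreover have "p \<notin> ?S"
        using False unfolding p by auto
      ultimately show ?thesis by blast
    qed
  qed
  with dims show ?thesis by (metis mat3.collapse)
qed

end

theory Submission
  imports Defs "HOL-Algebra.Algebraic_Closure_Type" "HOL-Library.Z2"
begin

text \<open>
  Both patterns project along the first coordinate onto a full \<open>2 \<times> 2\<close> square. Hence the product of
  \<open>{1..n}\<close> with a rectangle-free \<open>B \<subseteq> {1..n}\<^sup>2\<close> avoids them, and the point-line incidences
  \<open>d = a c + b\<close> over the field with \<open>2 ^ k\<close> elements give such a \<open>B\<close> of order \<open>n\<close> to the power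
  \<open>3/2\<close>. Conversely, remove from a matrix the first and the last 1-entry of every line in the first
  direction. If a layer of the rest contains a rectangle, then two of its corners and entries
  before and after the other two form the pattern; so every layer is rectangle-free and has
  at most of order \<open>n\<close> to the power \<open>3/2\<close> entries.

  For minimality it suffices to delete a single 1-entry. One of the positions of the pattern is then
  related to the remaining 1-entries by independent conditions, each asking for an entry in a fixed
  direction of signs. An entry violating such a condition is unique on its line in
  that direction, so only \<open>O(n\<^sup>2)\<close> entries violate one.
\<close>

section \<open>Containment of matrices\<close>

text \<open>A strictly increasing list is determined by its set of elements, so the values of
  \<open>f\<close> in order are the sorted list of the image.\<close>

lemma nth_elem_image:
  assumes "strict_mono_on {1..a} f" and "i \<in> {1..a}"
  shows "nth_elem (f ` {1..a}) i = f i"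
proof -
  have "sorted_wrt (<) (map f [1..<Suc a])"
    using assms(1) by (auto simp: sorted_wrt_iff_nth_less strict_mono_on_def simp del: upt_Suc)
  moreover have "set (map f [1..<Suc a]) = f ` {1..a}"
    by (auto simp: image_iff)
  ultimately have "sorted_list_of_set (f ` {1..a}) = map f [1..<Suc a]"
    by (metis ex1_sorted_list_for_set_if_finite finite_set set_sorted_list_of_set
        strict_sorted_list_of_set)
  then show ?thesis
    using assms(2) by (auto simp: nth_elem_def simp del: upt_Suc)
qed

lemma
  assumes "finite U"
  shows nth_elem_strict_mono: "strict_mono_on {1..card U} (nth_elem U)"
    and nth_elem_mem: "i \<in> {1..card U} \<Longrightarrow> nth_elem U i \<in> U"
proof -
  show "strict_mono_on {1..card U} (nth_elem U)"
    using assms strict_sorted_list_of_set[of U]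
    by (auto simp: strict_mono_on_def nth_elem_def sorted_wrt_iff_nth_less)
  show "nth_elem U i \<in> U" if "i \<in> {1..card U}"
  proof -
    have "sorted_list_of_set U ! (i - 1) \<in> set (sorted_list_of_set U)"
      using that by (intro nth_mem) auto
    then show ?thesis
      using assms by (simp add: nth_elem_def)
  qed
qed

text \<open>Both \<open>f\<close> and the identity enumerate \<open>{1..m}\<close> increasingly, and
  by \<open>nth_elem_image\<close> there is only one such enumeration.\<close>

lemma strict_mono_on_onto_interval:
  assumes "strict_mono_on {1..a::nat} f" and "f ` {1..a} = {1..m::nat}"
  shows "a = m" and "i \<in> {1..a} \<Longrightarrow> f i = i"
proof -
  show am: "a = m"
    using card_image[OF strict_mono_on_imp_inj_on[OF assms(1)]] assms(2) by simp
  show "f i = i" if "i \<in> {1..a}"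
    using nth_elem_image[OF assms(1) that] nth_elem_image[of a "\<lambda>i. i" i] that assms(2) am
    by (simp add: strict_mono_on_def)
qed

text \<open>Index maps replace the subsets in \<open>contains\<close>: they are the increasing
  enumerations of those subsets, compose directly and can be given explicitly.\<close>

definition embeds ::
    "mat3 \<Rightarrow> mat3 \<Rightarrow> (nat \<Rightarrow> nat) \<Rightarrow> (nat \<Rightarrow> nat) \<Rightarrow> (nat \<Rightarrow> nat) \<Rightarrow> bool" where
  "embeds P A f g h \<longleftrightarrow>
     strict_mono_on {1..dim1 P} f \<and> f ` {1..dim1 P} \<subseteq> {1..dim1 A} \<and>
     strict_mono_on {1..dim2 P} g \<and> g ` {1..dim2 P} \<subseteq> {1..dim2 A} \<and>
     strict_mono_on {1..dim3 P} h \<and> h ` {1..dim3 P} \<subseteq> {1..dim3 A} \<and>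
     (\<forall>(i, j, k) \<in> ones P. (f i, g j, h k) \<in> ones A)"

lemma contains_iff_embeds:
  assumes "is_mat3 P"
  shows "contains A P \<longleftrightarrow> (\<exists>f g h. embeds P A f g h)"
proof
  assume "contains A P"
  then obtain U V W where UVW: "U \<subseteq> {1..dim1 A}" "V \<subseteq> {1..dim2 A}" "W \<subseteq> {1..dim3 A}"
    and c: "card U = dim1 P" "card V = dim2 P" "card W = dim3 P"
    and sub: "ones P \<subseteq> ones (submat3 A U V W)"
    by (auto simp: contains_def submat3_def Let_def)
  have fin: "finite U" "finite V" "finite W"
    using UVW by (auto intro: finite_subset)
  have "(nth_elem U i, nth_elem V j, nth_elem W k) \<in> ones A" if "(i, j, k) \<in> ones P" for i j k
    using subsetD[OF sub that] by (simp add: submat3_def)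
  moreover have "nth_elem U ` {1..card U} \<subseteq> {1..dim1 A}" "nth_elem V ` {1..card V} \<subseteq> {1..dim2 A}"
    "nth_elem W ` {1..card W} \<subseteq> {1..dim3 A}"
    using UVW nth_elem_mem[OF fin(1)] nth_elem_mem[OF fin(2)] nth_elem_mem[OF fin(3)] by blast+
  ultimately have "embeds P A (nth_elem U) (nth_elem V) (nth_elem W)"
    using nth_elem_strict_mono[OF fin(1)] nth_elem_strict_mono[OF fin(2)]
      nth_elem_strict_mono[OF fin(3)]
    unfolding embeds_def c[symmetric] by auto
  then show "\<exists>f g h. embeds P A f g h" by blast
next
  assume "\<exists>f g h. embeds P A f g h"
  then obtain f g h where e: "embeds P A f g h" by blast
  then have mono: "strict_mono_on {1..dim1 P} f" "strict_mono_on {1..dim2 P} g"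
      "strict_mono_on {1..dim3 P} h"
    and ones: "\<And>i j k. (i, j, k) \<in> ones P \<Longrightarrow> (f i, g j, h k) \<in> ones A"
    by (auto simp: embeds_def)
  let ?U = "f ` {1..dim1 P}" and ?V = "g ` {1..dim2 P}" and ?W = "h ` {1..dim3 P}"
  have card: "card ?U = dim1 P" "card ?V = dim2 P" "card ?W = dim3 P"
    using mono[THEN strict_mono_on_imp_inj_on] by (simp_all add: card_image)
  have "ones P \<subseteq> ones (submat3 A ?U ?V ?W)"
  proof
    fix p assume p: "p \<in> ones P"
    obtain i j k where ijk: "p = (i, j, k)" by (cases p)
    have "i \<in> {1..dim1 P}" "j \<in> {1..dim2 P}" "k \<in> {1..dim3 P}"
      using p assms unfolding ijk is_mat3_def by auto
    then show "p \<in> ones (submat3 A ?U ?V ?W)"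
      using ones[of i j k] p
      by (simp add: submat3_def card ijk nth_elem_image[OF mono(1)] nth_elem_image[OF mono(2)]
          nth_elem_image[OF mono(3)] del: atLeastAtMost_iff One_nat_def)
  qed
  then show "contains A P"
    using e unfolding contains_def embeds_def
    by - (rule exI[of _ ?U], rule exI[of _ ?V], rule exI[of _ ?W],
      simp add: Let_def submat3_def card del: One_nat_def)
qed

lemma embeds_trans:
  assumes "embeds P Q f g h" and "embeds Q A f' g' h'"
  shows "embeds P A (f' \<circ> f) (g' \<circ> g) (h' \<circ> h)"
proof -
  have mono: "strict_mono_on S (u \<circ> v) \<and> (u \<circ> v) ` S \<subseteq> R"
    if "strict_mono_on S v" "v ` S \<subseteq> T" "strict_mono_on T u" "u ` T \<subseteq> R"
    for R S T and u v :: "nat \<Rightarrow> nat"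
    using that unfolding strict_mono_on_def by (simp add: image_subset_iff)
  have "(f' (f i), g' (g j), h' (h k)) \<in> ones A" if "(i, j, k) \<in> ones P" for i j k
    using assms that unfolding embeds_def by (metis (mono_tags, lifting) case_prodD)
  moreover have "strict_mono_on {1..dim1 P} (f' \<circ> f) \<and> (f' \<circ> f) ` {1..dim1 P} \<subseteq> {1..dim1 A}"
    "strict_mono_on {1..dim2 P} (g' \<circ> g) \<and> (g' \<circ> g) ` {1..dim2 P} \<subseteq> {1..dim2 A}"
    "strict_mono_on {1..dim3 P} (h' \<circ> h) \<and> (h' \<circ> h) ` {1..dim3 P} \<subseteq> {1..dim3 A}"
    using assms unfolding embeds_def by - (elim conjE, rule mono; assumption)+
  ultimately show ?thesis
    unfolding embeds_def by auto
qed

lemma ex3_le: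
  assumes "\<And>A. A \<in> free_mats n P \<Longrightarrow> card (ones A) \<le> b"
  shows "ex3 n P \<le> b"
  using assms finite_free_mats[of n P] by (auto simp: ex3_def)

lemma card_ones_le_ex3:
  assumes "A \<in> free_mats n P"
  shows "card (ones A) \<le> ex3 n P"
  using assms finite_free_mats[of n P] by (auto simp: ex3_def)

text \<open>Containment is transitive, so every \<open>P\<close>-free matrix is
  \<open>Q\<close>-free.\<close>

lemma ex3_mono_contains:
  assumes "is_mat3 P" "is_mat3 Q" "contains Q P"
  shows "ex3 n P \<le> ex3 n Q"
proof (rule ex3_le)
  fix A assume A: "A \<in> free_mats n P"
  have "contains A P" if "contains A Q"
    using that assms embeds_trans contains_iff_embeds by metis
  then have "A \<in> free_mats n Q"
    using A by (auto simp: free_mats_def)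
  then show "card (ones A) \<le> ex3 n Q"
    by (rule card_ones_le_ex3)
qed

text \<open>If every layer of \<open>P\<close> in every direction contains a 1-entry, then an embedding that hits all
  1-entries is the identity.\<close>

lemma properly_contained_delete_one:
  assumes P: "P = Mat3 a b c S" and S: "is_mat3 P"
    and full: "fst ` S = {1..a}" "(fst \<circ> snd) ` S = {1..b}" "(snd \<circ> snd) ` S = {1..c}"
    and P': "is_mat3 P'" "properly_contained P' P"
  shows "\<exists>e\<in>S. contains (Mat3 a b c (S - {e})) P'"
proof -
  have "contains P P'" using P'(2) by (simp add: properly_contained_def)
  then obtain f g h where e: "embeds P' P f g h"
    using P'(1) contains_iff_embeds by blast
  let ?\<phi> = "\<lambda>(i, j, k). (f i, g j, h k)"
  have sub: "?\<phi> ` ones P' \<subseteq> S"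
    using e by (auto simp: embeds_def P)
  have "?\<phi> ` ones P' \<noteq> S"
  proof
    assume eq: "?\<phi> ` ones P' = S"
    have in_box: "i \<in> {1..dim1 P'} \<and> j \<in> {1..dim2 P'} \<and> k \<in> {1..dim3 P'}"
      if "(i, j, k) \<in> ones P'" for i j k
      using that P'(1) by (auto simp: is_mat3_def)
    have "f ` {1..dim1 P'} = {1..a}"
    proof
      show "f ` {1..dim1 P'} \<subseteq> {1..a}" using e by (simp add: embeds_def P)
      show "{1..a} \<subseteq> f ` {1..dim1 P'}" unfolding full(1)[symmetric] eq[symmetric]
        using in_box by force
    qed
    moreover have "g ` {1..dim2 P'} = {1..b}"
    proof
      show "g ` {1..dim2 P'} \<subseteq> {1..b}" using e by (simp add: embeds_def P)
      show "{1..b} \<subseteq> g ` {1..dim2 P'}" unfolding full(2)[symmetric] eq[symmetric]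
        using in_box by force
    qed
    moreover have "h ` {1..dim3 P'} = {1..c}"
    proof
      show "h ` {1..dim3 P'} \<subseteq> {1..c}" using e by (simp add: embeds_def P)
      show "{1..c} \<subseteq> h ` {1..dim3 P'}" unfolding full(3)[symmetric] eq[symmetric]
        using in_box by force
    qed
    moreover have mono: "strict_mono_on {1..dim1 P'} f" "strict_mono_on {1..dim2 P'} g"
      "strict_mono_on {1..dim3 P'} h"
      using e by (auto simp: embeds_def)
    ultimately have dims: "dim1 P' = a" "dim2 P' = b" "dim3 P' = c"
      and id: "\<And>i. i \<in> {1..dim1 P'} \<Longrightarrow> f i = i" "\<And>j. j \<in> {1..dim2 P'} \<Longrightarrow> g j = j"
        "\<And>k. k \<in> {1..dim3 P'} \<Longrightarrow> h k = k"
      by (metis strict_mono_on_onto_interval)+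
    have "?\<phi> p = p" if "p \<in> ones P'" for p
      using that in_box id by (cases p) (simp del: atLeastAtMost_iff)
    then have "ones P' = S"
      using eq by (simp cong: image_cong_simp)
    with dims have "P' = P" unfolding P by (metis mat3.collapse)
    then show False using P'(2) by (simp add: properly_contained_def)
  qed
  \<comment> \<open>A 1-entry of \<open>P\<close> missed by the embedding can be deleted without
    destroying the embedding.\<close>
  then obtain p where p: "p \<in> S" "p \<notin> ?\<phi> ` ones P'" using sub by blast
  have "embeds P' (Mat3 a b c (S - {p})) f g h"
    using e p(2) by (simp add: embeds_def P image_iff split: prod.splits) (metis prod_cases3)
  then show ?thesis
    using p(1) P'(1) contains_iff_embeds by blast
qed

section \<open>Points seeing other points in prescribed directions\<close>

text \<open>Containment depends only on the order of coordinates, so a direction records signs; sign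
  0 keeps a coordinate fixed.\<close>

definition sees :: "int \<times> int \<times> int \<Rightarrow> nat \<times> nat \<times> nat \<Rightarrow> nat \<times> nat \<times> nat \<Rightarrow> bool" where
  "sees = (\<lambda>(a, b, c) (x, y, z) (x', y', z').
     sgn (int x' - int x) = a \<and> sgn (int y' - int y) = b \<and> sgn (int z' - int z) = c)"

definition directions :: "(int \<times> int \<times> int) set" where
  "directions = {-1, 0, 1} \<times> {-1, 0, 1} \<times> {-1, 0, 1} - {(0, 0, 0)}"

definition blind :: "(nat \<times> nat \<times> nat) set \<Rightarrow> int \<times> int \<times> int \<Rightarrow> (nat \<times> nat \<times> nat) set" where
  "blind A d = {p \<in> A. \<not> (\<exists>q\<in>A. sees d p q)}"

text \<open>Slopes of size at most 1 keep each integer that labels a line among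
  \<open>3 * n + 1\<close> values.\<close>

lemma shear_mem_interval:
  fixes s :: int
  assumes "s \<in> {-1, 0, 1}" "x \<in> {1..n}" "y \<in> {1..n::nat}"
  shows "int y - s * int x \<in> {- int n..2 * int n}"
  using assms by auto

text \<open>Two points on a line in direction \<open>d\<close> see each other along \<open>d\<close> in one of the two orders, so
  each line contains at most one blind point. The functions \<open>u\<close>, \<open>v\<close>, \<open>w\<close> are the coordinates in
  some order and \<open>(r, s, t)\<close> is \<open>d\<close> in the same order; a line is determined by two integers
  because \<open>r \<noteq> 0\<close>.\<close>

lemma card_blind_le_pivot:
  fixes u v w :: "nat \<times> nat \<times> nat \<Rightarrow> nat" and r s t :: int
  assumes range: "\<And>p. p \<in> A \<Longrightarrow> u p \<in> {1..n} \<and> v p \<in> {1..n} \<and> w p \<in> {1..n}"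
    and coords: "\<And>p q. u p = u q \<Longrightarrow> v p = v q \<Longrightarrow> w p = w q \<Longrightarrow> p = q"
    and sees: "\<And>p q. sgn (int (u q) - int (u p)) = r \<Longrightarrow> sgn (int (v q) - int (v p)) = s \<Longrightarrow>
      sgn (int (w q) - int (w p)) = t \<Longrightarrow> sees d p q"
    and r: "r = 1 \<or> r = -1" and s: "s \<in> {-1, 0, 1}" and t: "t \<in> {-1, 0, 1}"
  shows "card (blind A d) \<le> (3 * n + 1)\<^sup>2"
proof -
  let ?I = "{- int n..2 * int n}"
  \<comment> \<open>Moving along \<open>(r, s, t)\<close> leaves \<open>g\<close> unchanged because
    \<open>r * r = 1\<close>, so \<open>g p\<close> labels the line through
    \<open>p\<close>.\<close>
  define g where "g p = (int (v p) - (r * s) * int (u p), int (w p) - (r * t) * int (u p))" for p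
  have "card (blind A d) \<le> card (?I \<times> ?I)"
  proof (rule card_inj_on_le[where f = g])
    have "r * s \<in> {-1, 0, 1}" "r * t \<in> {-1, 0, 1}" using r s t by auto
    then show "g ` blind A d \<subseteq> ?I \<times> ?I"
      unfolding g_def blind_def using range by (blast intro: shear_mem_interval)
    show "inj_on g (blind A d)"
    proof (rule inj_onI)
      fix p q assume p: "p \<in> blind A d" and q: "q \<in> blind A d" and eq: "g p = g q"
      \<comment> \<open>The signed number of steps from \<open>p\<close> to \<open>q\<close> on
        their common line: if positive, \<open>p\<close> sees \<open>q\<close>; if negative,
        \<open>q\<close> sees \<open>p\<close>.\<close>
      define k where "k = r * (int (u q) - int (u p))"
      have k: "int (u q) - int (u p) = k * r" "int (v q) - int (v p) = k * s"
        "int (w q) - int (w p) = k * t"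
        using r eq by (auto simp: k_def g_def algebra_simps)
      have "\<not> k > 0"
      proof
        assume "k > 0"
        then have "sees d p q"
          using r s t by (intro sees) (auto simp: k)
        with p q show False by (auto simp: blind_def)
      qed
      moreover have "\<not> k < 0"
      proof
        assume neg: "k < 0"
        have "int (u p) - int (u q) = - k * r" "int (v p) - int (v q) = - k * s"
          "int (w p) - int (w q) = - k * t"
          using k by linarith+
        then have "sees d q p"
          using r s t neg by (intro sees) (auto simp: sgn_mult)
        with p q show False by (auto simp: blind_def)
      qed
      ultimately have "k = 0" by simp
      with k show "p = q" by (intro coords) auto
    qed
  qed simp
  also have "card (?I \<times> ?I) = (3 * n + 1)\<^sup>2"
    by (simp add: card_cartesian_product power2_eq_square nat_add_distrib nat_mult_distrib
        algebra_simps)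
  finally show ?thesis .
qed

text \<open>Any nonzero component of \<open>d\<close> can serve as the pivot; the constant comes
  from \<open>3 * n + 1 \<le> 4 * n\<close> for positive \<open>n\<close>.\<close>

lemma card_blind_le:
  assumes A: "A \<subseteq> {1..n} \<times> {1..n} \<times> {1..n}" and d: "d \<in> directions"
  shows "card (blind A d) \<le> 16 * n\<^sup>2"
proof (cases "n = 0")
  case True
  then have "A = {}" using A by auto
  then show ?thesis by (simp add: blind_def)
next
  case False
  obtain a b c where abc: "d = (a, b, c)" by (cases d)
  have mem: "a \<in> {-1, 0, 1}" "b \<in> {-1, 0, 1}" "c \<in> {-1, 0, 1}"
    using d by (auto simp: directions_def abc)
  have range: "fst p \<in> {1..n}" "fst (snd p) \<in> {1..n}" "snd (snd p) \<in> {1..n}" if "p \<in> A" for p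
    using subsetD[OF A that] by (auto simp: mem_Times_iff)
  have coords: "p = q" if "fst p = fst q" "fst (snd p) = fst (snd q)" "snd (snd p) = snd (snd q)"
    for p q :: "nat \<times> nat \<times> nat"
    using that by (intro prod_eqI)
  have seesI: "sees d p q"
    if "sgn (int (fst q) - int (fst p)) = a" "sgn (int (fst (snd q)) - int (fst (snd p))) = b"
      "sgn (int (snd (snd q)) - int (snd (snd p))) = c" for p q
    using that unfolding abc by (cases p; cases q) (simp add: sees_def)
  have "a = 1 \<or> a = -1 \<or> b = 1 \<or> b = -1 \<or> c = 1 \<or> c = -1"
    using d by (auto simp: directions_def abc)
  then consider "a = 1 \<or> a = -1" | "b = 1 \<or> b = -1" | "c = 1 \<or> c = -1" by blast
  then have "card (blind A d) \<le> (3 * n + 1)\<^sup>2"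
  proof cases
    case 1
    show ?thesis
      by (rule card_blind_le_pivot[where u = fst and v = "\<lambda>p. fst (snd p)"
            and w = "\<lambda>p. snd (snd p)", OF _ _ _ 1 mem(2,3)])
        (intro conjI range coords seesI; assumption)+
  next
    case 2
    show ?thesis
      by (rule card_blind_le_pivot[where u = "\<lambda>p. fst (snd p)" and v = fst
            and w = "\<lambda>p. snd (snd p)", OF _ _ _ 2 mem(1,3)])
        (intro conjI range coords seesI; assumption)+
  next
    case 3
    show ?thesis
      by (rule card_blind_le_pivot[where u = "\<lambda>p. snd (snd p)" and v = fst
            and w = "\<lambda>p. fst (snd p)", OF _ _ _ 3 mem(1,2)])
        (intro conjI range coords seesI; assumption)+
  qed
  also have "\<dots> \<le> (4 * n)\<^sup>2" using False by (intro power_mono) auto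
  finally show ?thesis by (simp add: power_mult_distrib)
qed

text \<open>Otherwise the blind sets of the directions in \<open>D\<close> would cover
  \<open>A\<close>, but together they are too small.\<close>

lemma ex_seeing_point:
  assumes A: "A \<subseteq> {1..n} \<times> {1..n} \<times> {1..n}" and D: "finite D" "D \<subseteq> directions"
    and card: "card A > 16 * card D * n\<^sup>2"
  shows "\<exists>p\<in>A. \<forall>d\<in>D. \<exists>q\<in>A. sees d p q"
proof (rule ccontr)
  assume "\<not> ?thesis"
  then have "A \<subseteq> (\<Union>d\<in>D. blind A d)" by (auto simp: blind_def)
  moreover have "finite A" using A by (rule finite_subset) simp
  then have "finite (\<Union>d\<in>D. blind A d)" using D by (auto simp: blind_def)
  ultimately have "card A \<le> card (\<Union>d\<in>D. blind A d)" by (simp add: card_mono)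
  also have "\<dots> \<le> (\<Sum>d\<in>D. card (blind A d))" using D(1) by (rule card_UN_le)
  also have "\<dots> \<le> (\<Sum>d\<in>D. 16 * n\<^sup>2)" using card_blind_le[OF A] D(2) by (intro sum_mono) auto
  finally show False using card by simp
qed

section \<open>A rectangle-free incidence relation\<close>

lemma CHAR_bit: "CHAR(bit) = 2"
proof (rule CHAR_eqI)
  show "of_nat 2 = (0 :: bit)" by simp
  show "2 dvd n" if "of_nat n = (0 :: bit)" for n
    using that by (metis even_of_nat_iff dvd_0_right)
qed

text \<open>The polynomial \<open>x ^ q - x\<close> splits into \<open>q\<close> linear factors. As
  \<open>q\<close> vanishes in the field, its derivative is the constant -1, whereas a repeated
  factor would give the derivative a root.\<close>

lemma card_roots_Frobenius:
  fixes q :: nat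
  assumes q: "q > 1" and zero: "of_nat q = (0 :: 'a :: alg_closed_field)"
  shows "finite {x :: 'a. x ^ q = x}" "card {x :: 'a. x ^ q = x} = q"
proof -
  define p :: "'a poly" where "p = monom 1 q + monom (-1) 1"
  have deg: "Polynomial.degree p = q"
    unfolding p_def using q by (subst degree_add_eq_left) (auto simp: degree_monom_eq)
  then have p0: "p \<noteq> 0" using q by auto
  obtain M where M: "size M = q" "p = smult (lead_coeff p) (\<Prod>x\<in>#M. [:-x, 1:])"
    using alg_closed_imp_factorization[OF p0] deg by auto
  have root_iff: "poly p x = 0 \<longleftrightarrow> x \<in># M" for x
    by (subst M(2)) (auto simp: p0 poly_prod_mset)
  have deriv: "poly (pderiv p) x = -1" for x
    unfolding p_def by (simp add: pderiv_add pderiv_monom zero poly_monom)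
  have "count M x = 1" if "x \<in># M" for x
  proof (rule ccontr)
    assume "count M x \<noteq> 1"
    moreover have "count M x > 0" using that by simp
    ultimately have "2 \<le> count M x" by linarith
    then have "{#x, x#} \<subseteq># M" by (intro mset_subset_eqI) auto
    then obtain N where N: "M = {#x, x#} + N" by (metis subset_mset.add_diff_inverse)
    define r where "r = smult (lead_coeff p) (\<Prod>x\<in>#N. [:-x, 1:])"
    have "p = [:-x, 1:] * ([:-x, 1:] * r)"
      by (subst M(2)) (simp add: N r_def ac_simps)
    then have "poly (pderiv p) x = 0"
      by (simp only: pderiv_mult poly_add poly_mult) simp
    with deriv show False by simp
  qed
  then have "card (set_mset M) = size M"
    by (simp add: size_multiset_overloaded_eq)
  moreover have "{x. x ^ q = x} = set_mset M"
    using root_iff by (auto simp: p_def poly_monom)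
  ultimately show "finite {x :: 'a. x ^ q = x}" "card {x :: 'a. x ^ q = x} = q"
    using M(1) by simp_all
qed

text \<open>The fixed points of the \<open>k\<close>-th iterate of the Frobenius map form the field
  with \<open>2 ^ k\<close> elements. Closure under sums and products suffices for incidences;
  differences are taken in the surrounding field.\<close>

lemma ex_finite_semiring:
  assumes "k > 0"
  shows "\<exists>F :: bit alg_closure set. finite F \<and> card F = 2 ^ k \<and>
           (\<forall>x\<in>F. \<forall>y\<in>F. x + y \<in> F \<and> x * y \<in> F)"
proof -
  have char: "CHAR(bit alg_closure) = 2" by (simp add: CHAR_bit)
  have "2 dvd (2::nat) ^ k" using assms by simp
  then have "of_nat (2 ^ k) = (0 :: bit alg_closure)"
    by (simp only: of_nat_eq_0_iff_char_dvd char)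
  moreover have "(2::nat) ^ k > 1" using assms by (intro one_less_power) auto
  moreover have "(x + y) ^ 2 ^ k = x ^ 2 ^ k + y ^ 2 ^ k" for x y :: "bit alg_closure"
    by (rule freshmans_dream'[where n = k]) (simp_all only: char two_is_prime_nat)
  ultimately show ?thesis
    by (intro exI[of _ "{x. x ^ 2 ^ k = x}"])
      (simp add: card_roots_Frobenius power_mult_distrib del: of_nat_power of_nat_numeral)
qed

text \<open>Read as a bipartite graph, \<open>B\<close> contains no 4-cycle.\<close>

definition rectangle_free :: "('a \<times> 'b) set \<Rightarrow> bool" where
  "rectangle_free B \<longleftrightarrow> (\<forall>y y' z z'. {y, y'} \<times> {z, z'} \<subseteq> B \<longrightarrow> y = y' \<or> z = z')"

text \<open>Points \<open>(a, b)\<close> and lines \<open>d = a c + b\<close> of an affine plane: two points lie on at most one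
  common line.\<close>

lemma ex_rectangle_free:
  fixes n :: nat
  assumes k: "k > 0" and n: "4 ^ k \<le> n"
  shows "\<exists>B. B \<subseteq> {1..n} \<times> {1..n} \<and> rectangle_free B \<and> card B = 8 ^ k"
proof -
  obtain F :: "bit alg_closure set" where F: "finite F" "card F = 2 ^ k"
    and closed: "\<And>x y. x \<in> F \<Longrightarrow> y \<in> F \<Longrightarrow> x + y \<in> F \<and> x * y \<in> F"
    using ex_finite_semiring[OF k] by blast
  have "card (F \<times> F) = (2 * 2) ^ k"
    by (simp only: card_cartesian_product F(2) power_mult_distrib)
  then have "card (F \<times> F) \<le> card {1..n}"
    using n by simp
  then obtain e where e: "inj_on e (F \<times> F)" "e ` (F \<times> F) \<subseteq> {1..n}"
    using card_le_inj[of "F \<times> F" "{1..n}"] F(1) by auto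
  have e_eq: "e (a, b) = e (c, d) \<longleftrightarrow> a = c \<and> b = d" if "a \<in> F" "b \<in> F" "c \<in> F" "d \<in> F" for a b c d
    using inj_on_eq_iff[OF e(1), of "(a, b)" "(c, d)"] that by simp
  \<comment> \<open>\<open>e\<close> numbers points and lines alike. A point \<open>(a, b)\<close>
    and a slope \<open>c\<close> determine the line through the point, hence one incidence for each
    triple.\<close>
  define \<phi> where "\<phi> = (\<lambda>(a, b, c). (e (a, b), e (c, a * c + b)))"
  have inj: "inj_on \<phi> (F \<times> F \<times> F)"
    unfolding \<phi>_def using closed by (auto simp: inj_on_def e_eq)
  have incident: "\<exists>a b c. a \<in> F \<and> b \<in> F \<and> c \<in> F \<and> y = e (a, b) \<and> z = e (c, a * c + b)"
    if "(y, z) \<in> \<phi> ` (F \<times> F \<times> F)" for y z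
    using that by (auto simp: \<phi>_def)
  have "rectangle_free (\<phi> ` (F \<times> F \<times> F))"
    unfolding rectangle_free_def
  proof (intro allI impI)
    fix y y' z z' assume sub: "{y, y'} \<times> {z, z'} \<subseteq> \<phi> ` (F \<times> F \<times> F)"
    obtain a b c where 1: "a \<in> F" "b \<in> F" "c \<in> F" "y = e (a, b)" "z = e (c, a * c + b)"
      using incident[of y z] sub by auto
    obtain a' b' c' where 2: "a' \<in> F" "b' \<in> F" "c' \<in> F" "y' = e (a', b')" "z' = e (c', a' * c' + b')"
      using incident[of y' z'] sub by auto
    have inc: "d = u * w + v"
      if h: "(e (u, v), e (w, d)) \<in> \<phi> ` (F \<times> F \<times> F)" "u \<in> F" "v \<in> F" "w \<in> F" "d \<in> F" for u v w d
    proof -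
      obtain u' v' w' where "u' \<in> F" "v' \<in> F" "w' \<in> F" "e (u, v) = e (u', v')"
        "e (w, d) = e (w', u' * w' + v')"
        using incident[OF h(1)] by blast
      then show ?thesis
        using h(2-) closed by (auto simp: e_eq)
    qed
    have inc_eq: "a' * c' + b' = a * c' + b" "a * c + b = a' * c + b'"
      using sub closed by (intro inc; simp add: 1 2)+
    \<comment> \<open>Subtracting the equations for the two lines eliminates \<open>b\<close> and
      \<open>b'\<close>; a field has no zero divisors.\<close>
    have "(a - a') * (c - c') = (a * c + b - (a' * c + b')) - (a * c' + b - (a' * c' + b'))"
      by (simp add: algebra_simps)
    then have "(a - a') * (c - c') = 0" using inc_eq by simp
    then have "a = a' \<or> c = c'" by auto
    then show "y = y' \<or> z = z'"
    proof
      assume "a = a'"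
      then show ?thesis using inc_eq(2) 1(4) 2(4) by simp
    next
      assume "c = c'"
      then show ?thesis using inc_eq(1) 1(5) 2(5) by simp
    qed
  qed
  moreover have "\<phi> ` (F \<times> F \<times> F) \<subseteq> {1..n} \<times> {1..n}"
    using e(2) closed by (auto simp: \<phi>_def image_subset_iff)
  moreover have "card (\<phi> ` (F \<times> F \<times> F)) = 8 ^ k"
  proof -
    have "card (\<phi> ` (F \<times> F \<times> F)) = (2 * (2 * 2)) ^ k"
      by (simp only: card_image[OF inj] card_cartesian_product F(2) power_mult_distrib)
    then show ?thesis by simp
  qed
  ultimately show ?thesis by blast
qed

section \<open>Upper bounds\<close>

text \<open>The lists serve as index maps of an embedding; \<open>- 1\<close> turns positions
  counted from 1 into list indices.\<close>

lemma contains_3_2_2I: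
  assumes S: "S \<subseteq> {1..3} \<times> {1..2} \<times> {1..2}"
    and dims: "1 \<le> x1" "x1 < x2" "x2 < x3" "x3 \<le> dim1 A" "1 \<le> y1" "y1 < y2" "y2 \<le> dim2 A"
      "1 \<le> z1" "z1 < z2" "z2 \<le> dim3 A"
    and ones: "\<And>i j k. (i, j, k) \<in> S \<Longrightarrow>
      ([x1, x2, x3] ! (i - 1), [y1, y2] ! (j - 1), [z1, z2] ! (k - 1)) \<in> ones A"
  shows "contains A (Mat3 3 2 2 S)"
proof -
  have "{1..3} = {1::nat, 2, 3}" "{1..2} = {1::nat, 2}" by auto
  then have "embeds (Mat3 3 2 2 S) A (\<lambda>i. [x1, x2, x3] ! (i - 1)) (\<lambda>i. [y1, y2] ! (i - 1))
      (\<lambda>i. [z1, z2] ! (i - 1))"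
    using dims ones unfolding embeds_def by (auto simp: strict_mono_on_def)
  then show ?thesis
    using S by (subst contains_iff_embeds) (auto simp: is_mat3_def)
qed

text \<open>A matrix with more than \<open>16 * card D * n\<^sup>2\<close> entries has one that sees
  along all of \<open>D\<close>, and around it the pattern is assembled.\<close>

lemma ex3_quadratic_by_directions:
  assumes D: "finite D" "D \<subseteq> directions"
    and contains: "\<And>n A p. A \<subseteq> {1..n} \<times> {1..n} \<times> {1..n} \<Longrightarrow> p \<in> A \<Longrightarrow>
      (\<And>d. d \<in> D \<Longrightarrow> \<exists>q\<in>A. sees d p q) \<Longrightarrow> contains (Mat3 n n n A) P"
  shows "(\<lambda>n. real (ex3 n P)) \<in> O(\<lambda>n. real n ^ 2)"
proof (rule bigoI[of _ "16 * real (card D)"], rule always_eventually, rule allI)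
  fix n
  have "ex3 n P \<le> 16 * card D * n\<^sup>2"
  proof (rule ex3_le, rule ccontr)
    fix A assume A: "A \<in> free_mats n P" and large: "\<not> card (ones A) \<le> 16 * card D * n\<^sup>2"
    have box: "ones A \<subseteq> {1..n} \<times> {1..n} \<times> {1..n}" and A_eq: "A = Mat3 n n n (ones A)"
      using A by (cases A; simp add: free_mats_def is_mat3_def)+
    obtain p where "p \<in> ones A" "\<forall>d\<in>D. \<exists>q\<in>ones A. sees d p q"
      using ex_seeing_point[OF box D] large by auto
    then have "contains A P"
      using contains[OF box] A_eq by metis
    then show False using A by (simp add: free_mats_def)
  qed
  from of_nat_mono[OF this, where 'a = real]
  show "norm (real (ex3 n P)) \<le> 16 * real (card D) * norm (real n ^ 2)" by simp
qed

lemma card_eq_sum_card_sections: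
  fixes n :: nat
  assumes "B \<subseteq> {1..n} \<times> C" "finite C"
  shows "card B = (\<Sum>y=1..n. card {z. (y, z) \<in> B})"
proof -
  have "B = (SIGMA y:{1..n}. {z. (y, z) \<in> B})" using assms(1) by auto
  then have "card B = card (SIGMA y:{1..n}. {z. (y, z) \<in> B})" by simp
  also have "\<dots> = (\<Sum>y=1..n. card {z. (y, z) \<in> B})"
  proof (rule card_SigmaI)
    have "{z. (y, z) \<in> B} \<subseteq> C" for y using assms(1) by auto
    then show "\<forall>y\<in>{1..n}. finite {z. (y, z) \<in> B}" using assms(2) finite_subset by blast
  qed simp
  finally show ?thesis .
qed

text \<open>The Kovari-Sos-Turan count: an ordered pair of distinct columns is shared by at most one
  row, which bounds the sum of the squared row sizes.\<close>

lemma card_rectangle_free_le: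
  fixes n :: nat
  assumes B: "B \<subseteq> {1..n} \<times> {1..n}" and rf: "rectangle_free B"
  shows "real (card B) \<le> 2 * real n * sqrt (real n)"
proof (cases "n = 0")
  case True
  then show ?thesis using B by simp
next
  case False
  let ?N = "\<lambda>y. {z. (y, z) \<in> B}"
  have N: "?N y \<subseteq> {1..n}" for y using B by auto
  then have finN: "finite (?N y)" for y by (rule finite_subset) simp
  have finB: "finite B" using B by (rule finite_subset) simp
  have cardB: "card B = (\<Sum>y=1..n. card (?N y))"
    using card_eq_sum_card_sections[OF B] by simp
  let ?T = "SIGMA y:{1..n}. ?N y \<times> ?N y"
  let ?T' = "{(y, z, z'). (y, z, z') \<in> ?T \<and> z \<noteq> z'}"
  have finT: "finite ?T" using finN by (intro finite_SigmaI) auto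
  have "(\<Sum>y=1..n. (card (?N y))\<^sup>2) = card ?T"
    using finN by (subst card_SigmaI) (auto simp: power2_eq_square card_cartesian_product)
  also have "\<dots> \<le> card ((\<lambda>(y, z). (y, z, z)) ` B \<union> ?T')"
    using finB finT by (intro card_mono finite_UnI) (auto intro: finite_subset[OF _ finT])
  also have "\<dots> \<le> card ((\<lambda>(y, z). (y, z, z)) ` B) + card ?T'"
    by (rule card_Un_le)
  also have "card ((\<lambda>(y, z). (y, z, z)) ` B) \<le> card B"
    using finB by (rule card_image_le)
  also have "card ?T' \<le> card ({1..n} \<times> {1..n})"
  proof (rule card_inj_on_le[where f = snd])
    show "inj_on snd ?T'"
      using rf by (fastforce simp: inj_on_def rectangle_free_def)
    show "snd ` ?T' \<subseteq> {1..n} \<times> {1..n}" using B by auto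
  qed simp
  finally have sq: "(\<Sum>y=1..n. (card (?N y))\<^sup>2) \<le> card B + n\<^sup>2"
    by (simp add: card_cartesian_product power2_eq_square)
  let ?s = "sqrt (real n)"
  have s: "?s * ?s = real n" "?s \<ge> 1" using False by simp_all
  \<comment> \<open>In place of Cauchy-Schwarz, the inequality of means between each row size and
    \<open>?s\<close> is summed over the rows.\<close>
  have "2 * ?s * real (card B) = (\<Sum>y=1..n. 2 * ?s * real (card (?N y)))"
    by (simp add: cardB sum_distrib_left)
  also have "\<dots> \<le> (\<Sum>y=1..n. real ((card (?N y))\<^sup>2) + real n)"
  proof (rule sum_mono)
    fix y
    show "2 * ?s * real (card (?N y)) \<le> real ((card (?N y))\<^sup>2) + real n"
      using zero_le_power2[of "?s - real (card (?N y))"] s(1)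
      by (simp add: power2_eq_square algebra_simps)
  qed
  also have "\<dots> = real (\<Sum>y=1..n. (card (?N y))\<^sup>2) + real n * real n"
    by (simp add: sum.distrib)
  also have "\<dots> \<le> real (card B) + 2 * real n * real n"
    using of_nat_mono[OF sq, where 'a = real] by (simp add: power2_eq_square)
  \<comment> \<open>Since \<open>?s \<ge> 1\<close>, this term is absorbed by half of the left
    side.\<close>
  also have "real (card B) \<le> ?s * real (card B)"
    using s(2) by (simp add: mult_le_cancel_right1)
  finally have "?s * real (card B) \<le> 2 * real n * real n" by (simp add: mult.commute)
  also have "\<dots> = 2 * real n * (?s * ?s)" by (simp only: s(1))
  also have "\<dots> = ?s * (2 * real n * ?s)" by (simp only: ac_simps)
  finally have "?s * real (card B) \<le> ?s * (2 * real n * ?s)" .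
  then show ?thesis using s(2) by (simp add: mult_le_cancel_left)
qed

text \<open>This isolates what the upper bound needs from a pattern: two corners fill its middle
  layer, the other two are replaced by an earlier and a later entry.\<close>

definition forced_by_rectangles :: "mat3 \<Rightarrow> bool" where
  "forced_by_rectangles P \<longleftrightarrow> (\<forall>n A x y y' z z'.
     A \<subseteq> {1..n} \<times> {1..n} \<times> {1..n} \<and> y < y' \<and> z < z' \<and>
     (\<forall>p\<in>{y, y'} \<times> {z, z'}. (x, p) \<in> A \<and> (\<exists>w<x. (w, p) \<in> A) \<and> (\<exists>w>x. (w, p) \<in> A)) \<longrightarrow>
     contains (Mat3 n n n A) P)"

text \<open>The constant is 2 from the rectangle-free layers plus twice 16 from the removed ends of
  lines.\<close>

lemma ex3_le_by_rectangles:
  assumes forced: "forced_by_rectangles P"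
  shows "real (ex3 n P) \<le> 34 * (real n ^ 2 * sqrt (real n))"
proof -
  have "real (card (ones M)) \<le> 34 * (real n ^ 2 * sqrt (real n))" if M: "M \<in> free_mats n P" for M
  proof (cases "n = 0")
    case True
    then show ?thesis using M by (simp add: free_mats_def is_mat3_def)
  next
    case False
    define A where "A = ones M"
    have A: "A \<subseteq> {1..n} \<times> {1..n} \<times> {1..n}" and M_eq: "M = Mat3 n n n A"
      unfolding A_def using M by (cases M; simp add: free_mats_def is_mat3_def)+
    have free: "\<not> contains (Mat3 n n n A) P"
      using M unfolding M_eq by (simp add: free_mats_def)
    \<comment> \<open>An entry blind along \<open>(1, 0, 0)\<close> is the last on its line, one
      blind along \<open>(-1, 0, 0)\<close> the first.\<close>
    define A' where "A' = A - blind A (1, 0, 0) - blind A (-1, 0, 0)"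
    have line: "(x, p) \<in> A \<and> (\<exists>w<x. (w, p) \<in> A) \<and> (\<exists>w>x. (w, p) \<in> A)" if "(x, p) \<in> A'" for x p
      using that by (auto simp: A'_def blind_def sees_def sgn_1_pos sgn_1_neg sgn_0_0 split: prod.splits)
    let ?L = "\<lambda>x. {p. (x, p) \<in> A'}"
    have L: "?L x \<subseteq> {1..n} \<times> {1..n}" for x using A by (auto simp: A'_def)
    have "rectangle_free (?L x)" for x
      unfolding rectangle_free_def
    proof (intro allI impI, rule ccontr)
      fix y y' z z' assume sub: "{y, y'} \<times> {z, z'} \<subseteq> ?L x" and "\<not> (y = y' \<or> z = z')"
      then have ne: "y \<noteq> y'" "z \<noteq> z'" by auto
      have all: "\<forall>p\<in>{y, y'} \<times> {z, z'}. (x, p) \<in> A \<and> (\<exists>w<x. (w, p) \<in> A) \<and> (\<exists>w>x. (w, p) \<in> A)"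
        using sub line by blast
      have "{min y y', max y y'} = {y, y'}" "{min z z', max z z'} = {z, z'}"
        by (auto simp: min_def max_def)
      moreover have "min y y' < max y y'" "min z z' < max z z'"
        using ne by auto
      ultimately have "contains (Mat3 n n n A) P"
        using A all
        by (intro forced[unfolded forced_by_rectangles_def, rule_format,
              of A n "min y y'" "max y y'" "min z z'" "max z z'" x]) simp
      then show False using free by blast
    qed
    then have layer: "real (card (?L x)) \<le> 2 * real n * sqrt (real n)" for x
      using L by (intro card_rectangle_free_le)
    have "A' \<subseteq> {1..n} \<times> ({1..n} \<times> {1..n})" using A by (auto simp: A'_def)
    then have "card A' = (\<Sum>x=1..n. card (?L x))"
      by (rule card_eq_sum_card_sections) simp
    then have "real (card A') \<le> (\<Sum>x=1..n. 2 * real n * sqrt (real n))"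
      using layer by (simp only: of_nat_sum sum_mono)
    also have "\<dots> = 2 * (real n ^ 2 * sqrt (real n))"
      by (simp add: power2_eq_square)
    finally have A'_le: "real (card A') \<le> 2 * (real n ^ 2 * sqrt (real n))" .
    have fin: "finite A" using A by (rule finite_subset) simp
    have "card A \<le> card (A' \<union> (blind A (1, 0, 0) \<union> blind A (-1, 0, 0)))"
      using fin by (intro card_mono) (auto simp: A'_def blind_def)
    also have "\<dots> \<le> card A' + (card (blind A (1, 0, 0)) + card (blind A (-1, 0, 0)))"
      by (meson card_Un_le add_left_mono order_trans)
    also have "\<dots> \<le> card A' + 32 * n\<^sup>2"
      using card_blind_le[OF A, of "(1, 0, 0)"] card_blind_le[OF A, of "(-1, 0, 0)"]
      by (simp add: directions_def)
    finally have "card A \<le> card A' + 32 * n\<^sup>2" .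
    from of_nat_mono[OF this, where 'a = real]
    have "real (card A) \<le> real (card A') + 32 * real n ^ 2" by simp
    also have "real n ^ 2 \<le> real n ^ 2 * sqrt (real n)"
      using False by (simp add: mult_le_cancel_left1)
    finally show ?thesis using A'_le by (simp add: A_def)
  qed
  \<comment> \<open>\<open>ex3\<close> is bounded through natural numbers, so the real bound passes
    through its floor.\<close>
  then have "ex3 n P \<le> nat \<lfloor>34 * (real n ^ 2 * sqrt (real n))\<rfloor>"
    by (intro ex3_le le_nat_floor)
  also have "real \<dots> \<le> 34 * (real n ^ 2 * sqrt (real n))"
    by (rule of_nat_floor) simp
  finally show ?thesis by simp
qed

section \<open>Deleting a 1-entry\<close>

text \<open>The suffix of a name is the position of the deleted entry. The set \<open>D\<close> lists the signs leading from
  one position of the pattern, played by \<open>p\<close>, to 1-entries in the missing coordinates; a direction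
  \<open>(-1, 0, 0)\<close> or \<open>(1, 0, 0)\<close> not leading to a 1-entry of the pattern only makes room for a layer.\<close>

lemma ex3_quadratic1_without_112:
  "(\<lambda>n. real (ex3 n (Mat3 3 2 2 {(2, 1, 1), (2, 2, 1), (3, 2, 2)}))) \<in> O(\<lambda>n. real n ^ 2)"
\<comment> \<open>\<open>p\<close> plays the 1-entry (2,2,1). The directions lead in turn to
  (2,1,1), to (3,2,2) and to an earlier layer \<open>x1\<close>.\<close>
proof (rule ex3_quadratic_by_directions[where D = "{(0, -1, 0), (1, 0, 1), (-1, 0, 0)}"])
  fix n A p
  assume A: "A \<subseteq> {1..n} \<times> {1..n} \<times> {1..n}" "p \<in> A"
    and s: "\<And>d. d \<in> {(0, -1, 0), (1, 0, 1), (-1, 0, 0)} \<Longrightarrow> \<exists>q\<in>A. sees d p q"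
  obtain x2 y2 z1 where p: "p = (x2, y2, z1)" by (cases p)
  have c: "(x2, y2, z1) \<in> A" using A(2) p by simp
  obtain y1 where y1: "(x2, y1, z1) \<in> A" "y1 < y2"
    using s[of "(0, -1, 0)"] unfolding p by (auto simp: sees_def sgn_1_pos sgn_1_neg sgn_0_0)
  obtain x3 z2 where x3: "(x3, y2, z2) \<in> A" "x2 < x3" "z1 < z2"
    using s[of "(1, 0, 1)"] unfolding p by (auto simp: sees_def sgn_1_pos sgn_1_neg sgn_0_0)
  obtain x1 where x1: "(x1, y2, z1) \<in> A" "x1 < x2"
    using s[of "(-1, 0, 0)"] unfolding p by (auto simp: sees_def sgn_1_pos sgn_1_neg sgn_0_0)
  show "contains (Mat3 n n n A) (Mat3 3 2 2 {(2, 1, 1), (2, 2, 1), (3, 2, 2)})"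
    by (rule contains_3_2_2I[of _ x1 x2 x3 _ y1 y2 z1 z2]) (use subsetD[OF A(1)] c y1 x3 x1 in auto)
qed (simp_all add: directions_def)

text \<open>The mirror image of deleting (1,1,2): reversing the first two coordinates preserves the
  pattern.\<close>

lemma ex3_quadratic1_without_322:
  "(\<lambda>n. real (ex3 n (Mat3 3 2 2 {(1, 1, 2), (2, 1, 1), (2, 2, 1)}))) \<in> O(\<lambda>n. real n ^ 2)"
proof (rule ex3_quadratic_by_directions[where D = "{(0, 1, 0), (-1, 0, 1), (1, 0, 0)}"])
  fix n A p
  assume A: "A \<subseteq> {1..n} \<times> {1..n} \<times> {1..n}" "p \<in> A"
    and s: "\<And>d. d \<in> {(0, 1, 0), (-1, 0, 1), (1, 0, 0)} \<Longrightarrow> \<exists>q\<in>A. sees d p q"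
  obtain x2 y1 z1 where p: "p = (x2, y1, z1)" by (cases p)
  have c: "(x2, y1, z1) \<in> A" using A(2) p by simp
  obtain y2 where y2: "(x2, y2, z1) \<in> A" "y1 < y2"
    using s[of "(0, 1, 0)"] unfolding p by (auto simp: sees_def sgn_1_pos sgn_1_neg sgn_0_0)
  obtain x1 z2 where x1: "(x1, y1, z2) \<in> A" "x1 < x2" "z1 < z2"
    using s[of "(-1, 0, 1)"] unfolding p by (auto simp: sees_def sgn_1_pos sgn_1_neg sgn_0_0)
  obtain x3 where x3: "(x3, y1, z1) \<in> A" "x2 < x3"
    using s[of "(1, 0, 0)"] unfolding p by (auto simp: sees_def sgn_1_pos sgn_1_neg sgn_0_0)
  show "contains (Mat3 n n n A) (Mat3 3 2 2 {(1, 1, 2), (2, 1, 1), (2, 2, 1)})"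
    by (rule contains_3_2_2I[of _ x1 x2 x3 _ y1 y2 z1 z2]) (use subsetD[OF A(1)] c y2 x1 x3 in auto)
qed (simp_all add: directions_def)

text \<open>Here \<open>p\<close> plays the 0-entry (2,2,2); the three remaining 1-entries supply
  \<open>z1\<close>, \<open>x3\<close>, and \<open>x1\<close> with \<open>y1\<close>.\<close>

lemma ex3_quadratic1_without_211:
  "(\<lambda>n. real (ex3 n (Mat3 3 2 2 {(1, 1, 2), (2, 2, 1), (3, 2, 2)}))) \<in> O(\<lambda>n. real n ^ 2)"
proof (rule ex3_quadratic_by_directions[where D = "{(0, 0, -1), (1, 0, 0), (-1, -1, 0)}"])
  fix n A p
  assume A: "A \<subseteq> {1..n} \<times> {1..n} \<times> {1..n}" "p \<in> A"
    and s: "\<And>d. d \<in> {(0, 0, -1), (1, 0, 0), (-1, -1, 0)} \<Longrightarrow> \<exists>q\<in>A. sees d p q"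
  obtain x2 y2 z2 where p: "p = (x2, y2, z2)" by (cases p)
  have c: "(x2, y2, z2) \<in> A" using A(2) p by simp
  obtain z1 where z1: "(x2, y2, z1) \<in> A" "z1 < z2"
    using s[of "(0, 0, -1)"] unfolding p by (auto simp: sees_def sgn_1_pos sgn_1_neg sgn_0_0)
  obtain x3 where x3: "(x3, y2, z2) \<in> A" "x2 < x3"
    using s[of "(1, 0, 0)"] unfolding p by (auto simp: sees_def sgn_1_pos sgn_1_neg sgn_0_0)
  obtain x1 y1 where x1: "(x1, y1, z2) \<in> A" "x1 < x2" "y1 < y2"
    using s[of "(-1, -1, 0)"] unfolding p by (auto simp: sees_def sgn_1_pos sgn_1_neg sgn_0_0)
  show "contains (Mat3 n n n A) (Mat3 3 2 2 {(1, 1, 2), (2, 2, 1), (3, 2, 2)})"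
    by (rule contains_3_2_2I[of _ x1 x2 x3 _ y1 y2 z1 z2]) (use subsetD[OF A(1)] c z1 x3 x1 in auto)
qed (simp_all add: directions_def)

text \<open>The mirror image of deleting (2,1,1) in the first two coordinates; \<open>p\<close>
  plays the 0-entry (2,1,2).\<close>

lemma ex3_quadratic1_without_221:
  "(\<lambda>n. real (ex3 n (Mat3 3 2 2 {(1, 1, 2), (2, 1, 1), (3, 2, 2)}))) \<in> O(\<lambda>n. real n ^ 2)"
proof (rule ex3_quadratic_by_directions[where D = "{(0, 0, -1), (-1, 0, 0), (1, 1, 0)}"])
  fix n A p
  assume A: "A \<subseteq> {1..n} \<times> {1..n} \<times> {1..n}" "p \<in> A"
    and s: "\<And>d. d \<in> {(0, 0, -1), (-1, 0, 0), (1, 1, 0)} \<Longrightarrow> \<exists>q\<in>A. sees d p q"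
  obtain x2 y1 z2 where p: "p = (x2, y1, z2)" by (cases p)
  have c: "(x2, y1, z2) \<in> A" using A(2) p by simp
  obtain z1 where z1: "(x2, y1, z1) \<in> A" "z1 < z2"
    using s[of "(0, 0, -1)"] unfolding p by (auto simp: sees_def sgn_1_pos sgn_1_neg sgn_0_0)
  obtain x1 where x1: "(x1, y1, z2) \<in> A" "x1 < x2"
    using s[of "(-1, 0, 0)"] unfolding p by (auto simp: sees_def sgn_1_pos sgn_1_neg sgn_0_0)
  obtain x3 y2 where x3: "(x3, y2, z2) \<in> A" "x2 < x3" "y1 < y2"
    using s[of "(1, 1, 0)"] unfolding p by (auto simp: sees_def sgn_1_pos sgn_1_neg sgn_0_0)
  show "contains (Mat3 n n n A) (Mat3 3 2 2 {(1, 1, 2), (2, 1, 1), (3, 2, 2)})"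
    by (rule contains_3_2_2I[of _ x1 x2 x3 _ y1 y2 z1 z2]) (use subsetD[OF A(1)] c z1 x1 x3 in auto)
qed (simp_all add: directions_def)

text \<open>The remaining 1-entries are the neighbours of the 0-entry (2,1,1), played by
  \<open>p\<close>, along the three axes; \<open>(-1, 0, 0)\<close> makes room for layer
  \<open>x1\<close>.\<close>

lemma ex3_quadratic2_without_122:
  "(\<lambda>n. real (ex3 n (Mat3 3 2 2 {(2, 1, 2), (2, 2, 1), (3, 1, 1)}))) \<in> O(\<lambda>n. real n ^ 2)"
proof (rule ex3_quadratic_by_directions[where D = "{(0, 0, 1), (0, 1, 0), (1, 0, 0), (-1, 0, 0)}"])
  fix n A p
  assume A: "A \<subseteq> {1..n} \<times> {1..n} \<times> {1..n}" "p \<in> A"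
    and s: "\<And>d. d \<in> {(0, 0, 1), (0, 1, 0), (1, 0, 0), (-1, 0, 0)} \<Longrightarrow> \<exists>q\<in>A. sees d p q"
  obtain x2 y1 z1 where p: "p = (x2, y1, z1)" by (cases p)
  have c: "(x2, y1, z1) \<in> A" using A(2) p by simp
  obtain z2 where z2: "(x2, y1, z2) \<in> A" "z1 < z2"
    using s[of "(0, 0, 1)"] unfolding p by (auto simp: sees_def sgn_1_pos sgn_1_neg sgn_0_0)
  obtain y2 where y2: "(x2, y2, z1) \<in> A" "y1 < y2"
    using s[of "(0, 1, 0)"] unfolding p by (auto simp: sees_def sgn_1_pos sgn_1_neg sgn_0_0)
  obtain x3 where x3: "(x3, y1, z1) \<in> A" "x2 < x3"
    using s[of "(1, 0, 0)"] unfolding p by (auto simp: sees_def sgn_1_pos sgn_1_neg sgn_0_0)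
  obtain x1 where x1: "(x1, y1, z1) \<in> A" "x1 < x2"
    using s[of "(-1, 0, 0)"] unfolding p by (auto simp: sees_def sgn_1_pos sgn_1_neg sgn_0_0)
  show "contains (Mat3 n n n A) (Mat3 3 2 2 {(2, 1, 2), (2, 2, 1), (3, 1, 1)})"
    by (rule contains_3_2_2I[of _ x1 x2 x3 _ y1 y2 z1 z2]) (use subsetD[OF A(1)] c z2 y2 x3 x1 in auto)
qed (simp_all add: directions_def)

text \<open>The mirror image of deleting (1,2,2): reversing all three coordinates preserves the
  pattern.\<close>

lemma ex3_quadratic2_without_311:
  "(\<lambda>n. real (ex3 n (Mat3 3 2 2 {(1, 2, 2), (2, 1, 2), (2, 2, 1)}))) \<in> O(\<lambda>n. real n ^ 2)"
proof (rule ex3_quadratic_by_directions[where D = "{(-1, 0, 0), (0, -1, 0), (0, 0, -1), (1, 0, 0)}"])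
  fix n A p
  assume A: "A \<subseteq> {1..n} \<times> {1..n} \<times> {1..n}" "p \<in> A"
    and s: "\<And>d. d \<in> {(-1, 0, 0), (0, -1, 0), (0, 0, -1), (1, 0, 0)} \<Longrightarrow> \<exists>q\<in>A. sees d p q"
  obtain x2 y2 z2 where p: "p = (x2, y2, z2)" by (cases p)
  have c: "(x2, y2, z2) \<in> A" using A(2) p by simp
  obtain x1 where x1: "(x1, y2, z2) \<in> A" "x1 < x2"
    using s[of "(-1, 0, 0)"] unfolding p by (auto simp: sees_def sgn_1_pos sgn_1_neg sgn_0_0)
  obtain y1 where y1: "(x2, y1, z2) \<in> A" "y1 < y2"
    using s[of "(0, -1, 0)"] unfolding p by (auto simp: sees_def sgn_1_pos sgn_1_neg sgn_0_0)
  obtain z1 where z1: "(x2, y2, z1) \<in> A" "z1 < z2"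
    using s[of "(0, 0, -1)"] unfolding p by (auto simp: sees_def sgn_1_pos sgn_1_neg sgn_0_0)
  obtain x3 where x3: "(x3, y2, z2) \<in> A" "x2 < x3"
    using s[of "(1, 0, 0)"] unfolding p by (auto simp: sees_def sgn_1_pos sgn_1_neg sgn_0_0)
  show "contains (Mat3 n n n A) (Mat3 3 2 2 {(1, 2, 2), (2, 1, 2), (2, 2, 1)})"
    by (rule contains_3_2_2I[of _ x1 x2 x3 _ y1 y2 z1 z2]) (use subsetD[OF A(1)] c x1 y1 z1 x3 in auto)
qed (simp_all add: directions_def)

text \<open>\<open>p\<close> plays the 1-entry (2,2,1); the outer entries (1,2,2) and (3,1,1) supply
  \<open>z2\<close> and \<open>y1\<close> independently.\<close>

lemma ex3_quadratic2_without_212: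
  "(\<lambda>n. real (ex3 n (Mat3 3 2 2 {(1, 2, 2), (2, 2, 1), (3, 1, 1)}))) \<in> O(\<lambda>n. real n ^ 2)"
proof (rule ex3_quadratic_by_directions[where D = "{(-1, 0, 1), (1, -1, 0)}"])
  fix n A p
  assume A: "A \<subseteq> {1..n} \<times> {1..n} \<times> {1..n}" "p \<in> A"
    and s: "\<And>d. d \<in> {(-1, 0, 1), (1, -1, 0)} \<Longrightarrow> \<exists>q\<in>A. sees d p q"
  obtain x2 y2 z1 where p: "p = (x2, y2, z1)" by (cases p)
  have c: "(x2, y2, z1) \<in> A" using A(2) p by simp
  obtain x1 z2 where x1: "(x1, y2, z2) \<in> A" "x1 < x2" "z1 < z2"
    using s[of "(-1, 0, 1)"] unfolding p by (auto simp: sees_def sgn_1_pos sgn_1_neg sgn_0_0)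
  obtain x3 y1 where x3: "(x3, y1, z1) \<in> A" "x2 < x3" "y1 < y2"
    using s[of "(1, -1, 0)"] unfolding p by (auto simp: sees_def sgn_1_pos sgn_1_neg sgn_0_0)
  show "contains (Mat3 n n n A) (Mat3 3 2 2 {(1, 2, 2), (2, 2, 1), (3, 1, 1)})"
    by (rule contains_3_2_2I[of _ x1 x2 x3 _ y1 y2 z1 z2]) (use subsetD[OF A(1)] c x1 x3 in auto)
qed (simp_all add: directions_def)

text \<open>Deleting (2,1,2) with the last two coordinates exchanged.\<close>

lemma ex3_quadratic2_without_221:
  "(\<lambda>n. real (ex3 n (Mat3 3 2 2 {(1, 2, 2), (2, 1, 2), (3, 1, 1)}))) \<in> O(\<lambda>n. real n ^ 2)"
proof (rule ex3_quadratic_by_directions[where D = "{(-1, 1, 0), (1, 0, -1)}"])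
  fix n A p
  assume A: "A \<subseteq> {1..n} \<times> {1..n} \<times> {1..n}" "p \<in> A"
    and s: "\<And>d. d \<in> {(-1, 1, 0), (1, 0, -1)} \<Longrightarrow> \<exists>q\<in>A. sees d p q"
  obtain x2 y1 z2 where p: "p = (x2, y1, z2)" by (cases p)
  have c: "(x2, y1, z2) \<in> A" using A(2) p by simp
  obtain x1 y2 where x1: "(x1, y2, z2) \<in> A" "x1 < x2" "y1 < y2"
    using s[of "(-1, 1, 0)"] unfolding p by (auto simp: sees_def sgn_1_pos sgn_1_neg sgn_0_0)
  obtain x3 z1 where x3: "(x3, y1, z1) \<in> A" "x2 < x3" "z1 < z2"
    using s[of "(1, 0, -1)"] unfolding p by (auto simp: sees_def sgn_1_pos sgn_1_neg sgn_0_0)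
  show "contains (Mat3 n n n A) (Mat3 3 2 2 {(1, 2, 2), (2, 1, 2), (3, 1, 1)})"
    by (rule contains_3_2_2I[of _ x1 x2 x3 _ y1 y2 z1 z2]) (use subsetD[OF A(1)] c x1 x3 in auto)
qed (simp_all add: directions_def)

section \<open>The lower bound\<close>

text \<open>An embedding into \<open>{1..n} \<times> B\<close> would project the full square
  \<open>{1, 2} \<times> {1, 2}\<close> onto a rectangle in \<open>B\<close>.\<close>

lemma card_le_ex3_of_rectangle_free:
  fixes n :: nat
  assumes n: "n > 0" and B: "B \<subseteq> {1..n} \<times> {1..n}" "rectangle_free B"
    and S: "S \<subseteq> {1..3} \<times> {1..2} \<times> {1..2}" "{1, 2} \<times> {1, 2} \<subseteq> snd ` S"
  shows "n * card B \<le> ex3 n (Mat3 3 2 2 S)"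
proof -
  let ?A = "Mat3 n n n ({1..n} \<times> B)" and ?P = "Mat3 3 2 2 S"
  have P: "is_mat3 ?P" using S(1) by (auto simp: is_mat3_def)
  have "\<not> contains ?A ?P"
  proof
    assume "contains ?A ?P"
    then obtain f g h where e: "embeds ?P ?A f g h" using contains_iff_embeds[OF P] by blast
    then have "g 1 < g 2" "h 1 < h 2" by (auto simp: embeds_def strict_mono_on_def)
    moreover have "(g j, h k) \<in> B" if "j \<in> {1, 2}" "k \<in> {1, 2}" for j k
    proof -
      have "(j, k) \<in> snd ` S" using that S(2) by blast
      then obtain i where "(i, j, k) \<in> S" by auto
      then show ?thesis using e by (auto simp: embeds_def)
    qed
    then have "{g 1, g 2} \<times> {h 1, h 2} \<subseteq> B" by blast
    then have "g 1 = g 2 \<or> h 1 = h 2" using B(2) unfolding rectangle_free_def by blast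
    ultimately show False by simp
  qed
  then have "?A \<in> free_mats n ?P"
    using B(1) n by (auto simp: free_mats_def is_mat3_def)
  then have "card (ones ?A) \<le> ex3 n ?P" by (rule card_ones_le_ex3)
  then show ?thesis by (simp add: card_cartesian_product)
qed

text \<open>Fields of characteristic 2 alone suffice: their planes have \<open>4 ^ k\<close> points,
  within a factor 4 of every \<open>n\<close>.\<close>

lemma ex_power_4_near:
  fixes n :: nat
  assumes "n \<ge> 4"
  shows "\<exists>k>0. 4 ^ k \<le> n \<and> n < 4 ^ (k + 1)"
proof -
  obtain k where k: "4 ^ k \<le> n" "n < 4 ^ (k + 1)"
    using ex_power_ivl1[of 4 n] assms by auto
  moreover have "k > 0" using k assms by (cases k) auto
  ultimately show ?thesis by blast
qed

text \<open>The factor 8 is the rounding loss: 4 in \<open>n\<close> and 2 in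
  \<open>sqrt n\<close>.\<close>

lemma le_ex3_of_projection:
  assumes n: "n \<ge> 4"
    and S: "S \<subseteq> {1..3} \<times> {1..2} \<times> {1..2}" "{1, 2} \<times> {1, 2} \<subseteq> snd ` S"
  shows "real n ^ 2 * sqrt (real n) \<le> 8 * real (ex3 n (Mat3 3 2 2 S))"
proof -
  obtain k where k: "k > 0" "4 ^ k \<le> n" "n < 4 ^ (k + 1)" using ex_power_4_near[OF n] by blast
  obtain B where B: "B \<subseteq> {1..n} \<times> {1..n}" "rectangle_free B" "card B = 8 ^ k"
    using ex_rectangle_free[OF k(1,2)] by blast
  have n_le: "real n \<le> 4 * 4 ^ k" using of_nat_mono[OF less_imp_le[OF k(3)], where 'a = real] by simp
  have "sqrt (real n) \<le> 2 * 2 ^ k"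
  proof (rule real_le_lsqrt)
    have "(2 * 2 ^ k :: real)\<^sup>2 = 4 * 4 ^ k"
      by (simp add: power2_eq_square flip: power_mult_distrib)
    then show "real n \<le> (2 * 2 ^ k)\<^sup>2" using n_le by simp
  qed simp_all
  then have "real n * sqrt (real n) \<le> (4 * 4 ^ k) * (2 * 2 ^ k)"
    using n_le by (intro mult_mono) auto
  also have "\<dots> = 8 * (8::real) ^ k" by (simp flip: power_mult_distrib)
  finally have "real n * (real n * sqrt (real n)) \<le> real n * (8 * 8 ^ k)"
    by (intro mult_left_mono) auto
  also have "\<dots> = 8 * real (n * card B)" using B by simp
  also have "\<dots> \<le> 8 * real (ex3 n (Mat3 3 2 2 S))"
    using card_le_ex3_of_rectangle_free[OF _ B(1,2) S] n by (simp flip: of_nat_mult)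
  finally show ?thesis by (simp add: power2_eq_square mult.assoc)
qed

section \<open>The growth of the extremal functions\<close>

lemma powr_two_and_half: "real n powr (5 / 2) = real n ^ 2 * sqrt (real n)"
proof (cases "n = 0")
  case False
  then have "real n powr (2 + 1 / 2) = real n powr 2 * real n powr (1 / 2)"
    by (simp only: powr_add)
  then show ?thesis using False by (simp add: powr_half_sqrt)
qed simp

text \<open>All that depends on the pattern becomes a hypothesis: projections for the lower bound,
  rectangles for the upper one, single deletions for minimality.\<close>

lemma ex3_bigtheta_and_minimal:
  fixes S :: "(nat \<times> nat \<times> nat) set"
  defines "P \<equiv> Mat3 3 2 2 S"
  assumes S: "S \<subseteq> {1..3} \<times> {1..2} \<times> {1..2}" "fst ` S = {1..3}" "{1, 2} \<times> {1, 2} \<subseteq> snd ` S"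
    and forced: "forced_by_rectangles P"
    and deleted: "\<And>e. e \<in> S \<Longrightarrow> (\<lambda>n. real (ex3 n (Mat3 3 2 2 (S - {e})))) \<in> O(\<lambda>n. real n ^ 2)"
  shows "(\<lambda>n. real (ex3 n P)) \<in> \<Theta>(\<lambda>n. real n powr 2.5) \<and> minimally_non_O_n2 P"
proof -
  have P: "is_mat3 P" using S(1) by (auto simp: P_def is_mat3_def)
  have upper: "(\<lambda>n. real (ex3 n P)) \<in> O(\<lambda>n. real n powr 2.5)"
    using ex3_le_by_rectangles[OF forced]
    by (intro bigoI[of _ 34] always_eventually) (simp add: powr_two_and_half)
  have "eventually (\<lambda>n. real n powr 2.5 \<le> 8 * real (ex3 n P)) at_top"
    using eventually_ge_at_top[of 4]
    by eventually_elim (use le_ex3_of_projection[OF _ S(1,3)] in \<open>simp add: powr_two_and_half P_def\<close>)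
  then have lower: "(\<lambda>n. real (ex3 n P)) \<in> \<Omega>(\<lambda>n. real n powr 2.5)"
    by (intro landau_omega.bigI[of "1 / 8"]) (auto elim: eventually_mono)
  have theta: "(\<lambda>n. real (ex3 n P)) \<in> \<Theta>(\<lambda>n. real n powr 2.5)"
    using upper lower by (rule bigthetaI)
  \<comment> \<open>For positive \<open>n\<close> the quotient is \<open>sqrt n\<close>, which is
    unbounded.\<close>
  have "(\<lambda>n. real n powr 2.5) \<in> \<omega>(\<lambda>n. real n ^ 2)"
  proof (rule smallomegaI_filterlim_at_top_norm)
    have lim: "filterlim (\<lambda>n. sqrt (real n)) at_top at_top"
      by (rule filterlim_compose[OF sqrt_at_top filterlim_real_sequentially])
    have eq: "eventually (\<lambda>n. sqrt (real n) = norm (real n powr 2.5 / real n ^ 2)) at_top"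
      using eventually_gt_at_top[of 0]
      by eventually_elim (simp add: powr_two_and_half)
    show "filterlim (\<lambda>n. norm (real n powr 2.5 / real n ^ 2)) at_top at_top"
      by (rule iffD1[OF filterlim_cong[OF refl refl eq] lim])
  qed
  with lower have omega: "(\<lambda>n. real (ex3 n P)) \<in> \<omega>(\<lambda>n. real n ^ 2)"
    by (rule landau_omega.big_small_trans)
  have "(\<lambda>n. real (ex3 n P')) \<in> O(\<lambda>n. real n ^ 2)"
    if P': "is_mat3 P'" "properly_contained P' P" for P'
  proof -
    have sub: "snd ` S \<subseteq> {1..2} \<times> {1..2}" using S(1) by auto
    have "{1..2} = {1::nat, 2}" by auto
    then have "snd ` S = {1..2} \<times> {1..2}" using sub S(3) by auto
    then have full: "(fst \<circ> snd) ` S = {1..2}" "(snd \<circ> snd) ` S = {1..2}"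
      by (auto simp flip: image_image simp: image_comp[symmetric])
    obtain e where e: "e \<in> S" "contains (Mat3 3 2 2 (S - {e})) P'"
      using properly_contained_delete_one[OF P_def[THEN meta_eq_to_obj_eq] P S(2) full P'] by blast
    have "is_mat3 (Mat3 3 2 2 (S - {e}))" using S(1) by (auto simp: is_mat3_def)
    then have "ex3 n P' \<le> ex3 n (Mat3 3 2 2 (S - {e}))" for n
      using ex3_mono_contains P'(1) e(2) by blast
    then have "(\<lambda>n. real (ex3 n P')) \<in> O(\<lambda>n. real (ex3 n (Mat3 3 2 2 (S - {e}))))"
      by (intro landau_o.big_mono always_eventually) simp
    also note deleted[OF e(1)]
    finally show ?thesis .
  qed
  with omega have "minimally_non_O_n2 P" by (simp add: minimally_non_O_n2_def)
  with theta show ?thesis by blast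
qed

theorem lemma3p18:
  fixes P :: mat3
  assumes "P \<in> {mat3_of_layers [[[0, 1], [0, 0]], [[1, 0], [1, 0]], [[0, 0], [0, 1]]],
                 mat3_of_layers [[[0, 0], [0, 1]], [[0, 1], [1, 0]], [[1, 0], [0, 0]]]}"
  shows "(\<lambda>n. real (ex3 n P)) \<in> \<Theta>(\<lambda>n. real n powr 2.5) \<and> minimally_non_O_n2 P"
proof -
  let ?S1 = "{(1,1,2), (2,1,1), (2,2,1), (3,2,2)} :: (nat \<times> nat \<times> nat) set"
  let ?S2 = "{(1,2,2), (2,1,2), (2,2,1), (3,1,1)} :: (nat \<times> nat \<times> nat) set"
  have ivl: "{1..3} = {1::nat, 2, 3}" "{1..2} = {1::nat, 2}" by auto
  have "(\<lambda>n. real (ex3 n (Mat3 3 2 2 ?S1))) \<in> \<Theta>(\<lambda>n. real n powr 2.5) \<and>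
    minimally_non_O_n2 (Mat3 3 2 2 ?S1)"
  proof (rule ex3_bigtheta_and_minimal)
    have "contains (Mat3 n n n A) (Mat3 3 2 2 ?S1)"
      if A: "A \<subseteq> {1..n} \<times> {1..n} \<times> {1..n}" and less: "y < y'" "z < z'"
        and corners: "\<forall>p\<in>{y, y'} \<times> {z, z'}. (x, p) \<in> A \<and> (\<exists>w<x. (w, p) \<in> A) \<and> (\<exists>w>x. (w, p) \<in> A)"
      for n A x y y' z z'
    proof -
      \<comment> \<open>The corners in column \<open>z\<close> stay in layer \<open>x\<close>; those
        in column \<open>z'\<close> are replaced by an earlier and a later entry.\<close>
      obtain x1 x3 where x1: "x1 < x" "(x1, y, z') \<in> A" and x3: "x < x3" "(x3, y', z') \<in> A"
        using corners by auto
      have "(x, y, z) \<in> A" "(x, y', z) \<in> A" using corners by auto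
      then show ?thesis
        by (intro contains_3_2_2I[of _ x1 x x3 _ y y' z z'])
          (use less x1 x3 subsetD[OF A] in auto)
    qed
    then show "forced_by_rectangles (Mat3 3 2 2 ?S1)"
      unfolding forced_by_rectangles_def by blast
    show "(\<lambda>n. real (ex3 n (Mat3 3 2 2 (?S1 - {e})))) \<in> O(\<lambda>n. real n ^ 2)" if "e \<in> ?S1" for e
      using that ex3_quadratic1_without_112 ex3_quadratic1_without_211
        ex3_quadratic1_without_221 ex3_quadratic1_without_322
      by (elim insertE emptyE) (simp_all add: insert_Diff_if)
  qed (auto simp: ivl)
  moreover have "(\<lambda>n. real (ex3 n (Mat3 3 2 2 ?S2))) \<in> \<Theta>(\<lambda>n. real n powr 2.5) \<and>
    minimally_non_O_n2 (Mat3 3 2 2 ?S2)"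
  proof (rule ex3_bigtheta_and_minimal)
    have "contains (Mat3 n n n A) (Mat3 3 2 2 ?S2)"
      if A: "A \<subseteq> {1..n} \<times> {1..n} \<times> {1..n}" and less: "y < y'" "z < z'"
        and corners: "\<forall>p\<in>{y, y'} \<times> {z, z'}. (x, p) \<in> A \<and> (\<exists>w<x. (w, p) \<in> A) \<and> (\<exists>w>x. (w, p) \<in> A)"
      for n A x y y' z z'
    proof -
      \<comment> \<open>Here one diagonal of the rectangle stays in layer \<open>x\<close> and the
        corners of the other are replaced.\<close>
      obtain x1 x3 where x1: "x1 < x" "(x1, y', z') \<in> A" and x3: "x < x3" "(x3, y, z) \<in> A"
        using corners by auto
      have "(x, y, z') \<in> A" "(x, y', z) \<in> A" using corners by auto
      then show ?thesis
        by (intro contains_3_2_2I[of _ x1 x x3 _ y y' z z'])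
          (use less x1 x3 subsetD[OF A] in auto)
    qed
    then show "forced_by_rectangles (Mat3 3 2 2 ?S2)"
      unfolding forced_by_rectangles_def by blast
    show "(\<lambda>n. real (ex3 n (Mat3 3 2 2 (?S2 - {e})))) \<in> O(\<lambda>n. real n ^ 2)" if "e \<in> ?S2" for e
      using that ex3_quadratic2_without_122 ex3_quadratic2_without_212
        ex3_quadratic2_without_221 ex3_quadratic2_without_311
      by (elim insertE emptyE) (simp_all add: insert_Diff_if)
  qed (auto simp: ivl)
  ultimately show ?thesis
    using assms unfolding matrix1_ones matrix2_ones by blast
qed

end
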